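(* Let $\Pi$ be a (not necessarily Desarguesian) projective plane of order $q$, and let $t$ be a nonnegative integer with $t\le q^2+q+1$. Then the following are equivalent: (i) there exist chambers $(P_1,\ell_1),\dots,(P_t,\ell_t)$ of $\Pi$ such that every chamber $(P,\ell)$ of $\Pi$ satisfies $P=P_i$ or $\ell=\ell_i$ for some $i\in\{1,\dots,t\}$ (equivalently, there is a proper $t$-coloring of $\Gamma_q$ each of whose color classes is contained in a chamber coclique); (ii) there exist a set $X$ of points and a set $Y$ of lines of $\Pi$ with $|X|=|Y|=q^2+q+1-t$ such that no point of $X$ is incident with a line of $Y$.
   Context: A chamber of a projective plane is an incident point-line pair $(P,\ell)$, $P\in\ell$. The Kneser graph $\Gamma_q$ on chambers of $\Pi$ has the chambers as vertices, with $(P_1,\ell_1)$ and $(P_2,\ell_2)$ adjacent iff $P_1\notin\ell_2$ and $P_2\notin\ell_1$. For a chamber $(P,\ell)$, the chamber coclique determined by it is the set of all chambers whose point is $P$ or whose line is $\ell$ (a coclique of $\Gamma_q$ of size $2q+1$). *)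

theory Defs
  imports Main
begin

text \<open>Incidence is an abstract relation between points and lines. In the order \<open>q\<close> version the
  condition on line sizes makes all lines finite, since their cardinality \<open>q + 1\<close> is positive; the
  quadrangle forces \<open>q \<ge> 2\<close>.\<close>

locale projective_plane =
  fixes Points :: "'p set" and Lines :: "'l set" and inc :: "'p \<Rightarrow> 'l \<Rightarrow> bool"
  assumes unique_line:
    "\<lbrakk>P \<in> Points; Q \<in> Points; P \<noteq> Q\<rbrakk> \<Longrightarrow> \<exists>!l. l \<in> Lines \<and> inc P l \<and> inc Q l"
  and unique_point:
    "\<lbrakk>l \<in> Lines; m \<in> Lines; l \<noteq> m\<rbrakk> \<Longrightarrow> \<exists>!P. P \<in> Points \<and> inc P l \<and> inc P m"
  and quadrangle:
    "\<exists>Q \<subseteq> Points. card Q = 4 \<and> (\<forall>l \<in> Lines. card {P \<in> Q. inc P l} \<le> 2)"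

locale projective_plane_of_order = projective_plane Points Lines inc
  for Points :: "'p set" and Lines :: "'l set" and inc :: "'p \<Rightarrow> 'l \<Rightarrow> bool" +
  fixes q :: nat
  assumes line_size: "l \<in> Lines \<Longrightarrow> card {P \<in> Points. inc P l} = q + 1"

definition chambers :: "'p set \<Rightarrow> 'l set \<Rightarrow> ('p \<Rightarrow> 'l \<Rightarrow> bool) \<Rightarrow> ('p \<times> 'l) set" where
  "chambers Points Lines inc = {(P, l). P \<in> Points \<and> l \<in> Lines \<and> inc P l}"

definition kneser_adj :: "('p \<Rightarrow> 'l \<Rightarrow> bool) \<Rightarrow> 'p \<times> 'l \<Rightarrow> 'p \<times> 'l \<Rightarrow> bool" where
  "kneser_adj inc c d \<longleftrightarrow> \<not> inc (fst c) (snd d) \<and> \<not> inc (fst d) (snd c)"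

definition chamber_coclique ::
  "'p set \<Rightarrow> 'l set \<Rightarrow> ('p \<Rightarrow> 'l \<Rightarrow> bool) \<Rightarrow> 'p \<times> 'l \<Rightarrow> ('p \<times> 'l) set" where
  "chamber_coclique Points Lines inc c =
     {d \<in> chambers Points Lines inc. fst d = fst c \<or> snd d = snd c}"

text \<open>The colors are \<open>1, \<dots>, t\<close>; not all of them need be used.\<close>

definition proper_coloring ::
  "'v set \<Rightarrow> ('v \<Rightarrow> 'v \<Rightarrow> bool) \<Rightarrow> nat \<Rightarrow> ('v \<Rightarrow> nat) \<Rightarrow> bool" where
  "proper_coloring V adj t f \<longleftrightarrow>
     f ` V \<subseteq> {1..t} \<and> (\<forall>u \<in> V. \<forall>v \<in> V. adj u v \<longrightarrow> f u \<noteq> f v)"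

end

theory Submission
  imports Defs "HOL-Analysis.Convex"
begin

text \<open>
  Let \<open>n = q\<^sup>2 + q + 1\<close> and \<open>k = n - t\<close>. Going from chambers to \<open>X\<close> and \<open>Y\<close> only takes complements.
  Conversely, a matching of \<open>A = Points - X\<close> with \<open>B = Lines - Y\<close> inside the incidence graph yields
  the chambers. If Hall's condition failed, there would be \<open>S \<subseteq> A\<close> and \<open>T \<subseteq> B\<close> without incidences
  between them and with \<open>a + b > n - k\<close>, where \<open>a = |S|\<close> and \<open>b = |T|\<close>. Counting incidences
  with the Cauchy--Schwarz inequality gives \<open>ab \<le> q(n - a - b)\<close> for every such pair, and also
  \<open>k\<^sup>2 \<le> q(n - 2k)\<close> for \<open>X\<close> and \<open>Y\<close>. On the other hand, the lines joining a point of \<open>S\<close> to the points of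
  \<open>X\<close> lie in \<open>B - T\<close>, which has fewer than \<open>a\<close> elements; hence \<open>k \<le> q(a - 1)\<close>, and dually
  \<open>k \<le> q(b - 1)\<close>. These inequalities are contradictory.
\<close>

section \<open>Hall's theorem\<close>

text \<open>The induction of Halmos and Vaughan. If some nonempty proper subset \<open>S\<close> is
  critical, that is, has exactly \<open>card S\<close> neighbours, then \<open>S\<close> and
  \<open>A - S\<close> are matched separately, the latter away from the neighbours of
  \<open>S\<close>. Otherwise every nonempty proper subset has a neighbour to spare, so an arbitrary
  pair can be matched and removed.\<close>

lemma hall_marriage:
  fixes N :: "'a \<Rightarrow> 'b set"
  assumes "finite A" and "\<And>a. a \<in> A \<Longrightarrow> finite (N a)"
    and "\<And>S. S \<subseteq> A \<Longrightarrow> card S \<le> card (\<Union>(N ` S))"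
  shows "\<exists>f. inj_on f A \<and> (\<forall>a\<in>A. f a \<in> N a)"
  using assms
proof (induction A arbitrary: N rule: finite_psubset_induct)
  case (psubset A)
  have fin: "finite (\<Union>(N ` S))" if "S \<subseteq> A" for S
    using that psubset.prems(1) psubset.hyps by (auto intro: finite_subset)
  consider "A = {}"
    | (critical) S where "S \<subset> A" "S \<noteq> {}" "card (\<Union>(N ` S)) = card S"
    | (slack) "A \<noteq> {}" "\<And>S. S \<subset> A \<Longrightarrow> S \<noteq> {} \<Longrightarrow> card S < card (\<Union>(N ` S))"
    using psubset.prems(2) by (metis order.strict_iff_order psubset_imp_subset)
  then show ?case
  proof cases
    case 1
    then show ?thesis by auto
  next
    case critical
    define U where "U = \<Union>(N ` S)"
    have "\<exists>f. inj_on f S \<and> (\<forall>a\<in>S. f a \<in> N a)"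
      using critical(1) psubset.prems by (intro psubset.IH) auto
    then obtain f where f: "inj_on f S" "\<And>a. a \<in> S \<Longrightarrow> f a \<in> N a" by blast
    have "\<exists>g. inj_on g (A - S) \<and> (\<forall>a\<in>A - S. g a \<in> N a - U)"
    proof (rule psubset.IH)
      show "A - S \<subset> A" using critical by auto
      show "finite (N a - U)" if "a \<in> A - S" for a
        using that psubset.prems(1) by auto
      fix T assume T: "T \<subseteq> A - S"
      \<comment> \<open>Hall's condition survives the removal of \<open>U\<close>: it is applied to
        \<open>S \<union> T\<close>, and \<open>card U = card S\<close> cancels.\<close>
      have "card S + card T = card (S \<union> T)"
        using T critical(1) psubset.hyps
        by (intro card_Un_disjoint[symmetric]) (auto intro: finite_subset)
      also have "\<dots> \<le> card (\<Union>(N ` (S \<union> T)))"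
        using T critical(1) by (intro psubset.prems(2)) auto
      also have "\<Union>(N ` (S \<union> T)) = U \<union> (\<Union>a\<in>T. N a - U)"
        by (auto simp: U_def)
      also have "card \<dots> \<le> card U + card (\<Union>a\<in>T. N a - U)"
        by (rule card_Un_le)
      finally show "card T \<le> card (\<Union>a\<in>T. N a - U)"
        using critical(3) by (simp add: U_def)
    qed
    then obtain g where g: "inj_on g (A - S)" "\<And>a. a \<in> A - S \<Longrightarrow> g a \<in> N a - U" by blast
    have "inj_on (\<lambda>a. if a \<in> S then f a else g a) A"
      using inj_on_disjoint_Un[OF f(1) g(1)] f(2) g(2) critical(1)
      by (force simp: U_def Un_absorb1)
    moreover have "\<forall>a\<in>A. (if a \<in> S then f a else g a) \<in> N a"
      using f g by auto
    ultimately show ?thesis by blast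
  next
    case slack
    then obtain a where a: "a \<in> A" by blast
    then have "card {a} \<le> card (\<Union>(N ` {a}))"
      by (intro psubset.prems(2)) auto
    then obtain b where b: "b \<in> N a" by fastforce
    have "\<exists>g. inj_on g (A - {a}) \<and> (\<forall>x\<in>A - {a}. g x \<in> N x - {b})"
    proof (rule psubset.IH)
      show "A - {a} \<subset> A" using a by auto
      show "finite (N x - {b})" if "x \<in> A - {a}" for x
        using that psubset.prems(1) by auto
      fix T assume T: "T \<subseteq> A - {a}"
      have eq: "(\<Union>x\<in>T. N x - {b}) = \<Union>(N ` T) - {b}" by auto
      \<comment> \<open>\<open>T\<close> misses \<open>a\<close>, hence is a proper subset of
        \<open>A\<close>, and its surplus of one pays for the loss of \<open>b\<close>.\<close>
      have "card T - 1 < card (\<Union>(N ` T)) \<and> card T \<le> card (\<Union>(N ` T)) - 1" if "T \<noteq> {}"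
        using slack(2)[of T] T a that by fastforce
      moreover have "card (\<Union>(N ` T)) - 1 \<le> card (\<Union>(N ` T) - {b})"
        by (metis diff_le_self card_Diff_singleton_if order_refl)
      ultimately show "card T \<le> card (\<Union>x\<in>T. N x - {b})"
        unfolding eq by fastforce
    qed
    then obtain g where g: "inj_on g (A - {a})" "\<And>x. x \<in> A - {a} \<Longrightarrow> g x \<in> N x - {b}" by blast
    have "inj_on (g(a := b)) A"
      using g unfolding inj_on_def by (auto; blast)
    moreover have "\<forall>x\<in>A. (g(a := b)) x \<in> N x"
      using g b by auto
    ultimately show ?thesis by blast
  qed
qed

section \<open>Counting in a plane\<close>

text \<open>Here \<open>a\<close>, \<open>b\<close> and \<open>k\<close> stand for the sizes of
  \<open>S\<close>, \<open>T\<close> and of both \<open>X\<close> and \<open>Y\<close>. The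
  conditions on \<open>S\<close> and \<open>T\<close> force \<open>k\<close> to be large, at least
  \<open>q\<close> and with \<open>k^2\<close> at least \<open>q^2 * (q + 1)\<close>, whereas
  \<open>XY\<close> keeps it small.\<close>

lemma nonincident_bounds_contradictory:
  fixes a b k q n :: int
  assumes n: "n = q^2 + q + 1" and pos: "0 \<le> q" "1 \<le> a" "1 \<le> b"
    and XY: "k * k + q * (k + k) \<le> q * n" and ST: "a * b + q * (a + b) \<le> q * n"
    and a: "k + q \<le> q * a" and b: "k + q \<le> q * b"
    and big: "n - k < a + b"
  shows False
proof -
  have "1 \<le> a * b" using pos mult_mono[of 1 a 1 b] by simp
  moreover have "q * (n - k + 1) \<le> q * (a + b)" using pos big by (intro mult_left_mono) auto
  ultimately have "1 \<le> q * (k - 1)" using ST by (simp add: algebra_simps)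
  then have "0 < q * (k - 1)" by simp
  then have q: "1 \<le> q" and k: "2 \<le> k" using pos by (auto simp: zero_less_mult_iff)
  \<comment> \<open>The product of two nonnegative slacks bounds \<open>a * b\<close> from below by
    an expression linear in \<open>a + b\<close>; then \<open>ST\<close> involves only
    \<open>a + b\<close>, for which \<open>big\<close> gives a lower bound.\<close>
  have "0 \<le> (q * a - (k + q)) * (q * b - (k + q))"
    using a b by simp
  then have 1: "q * (k + q) * (a + b) - (k + q)^2 \<le> q^2 * (a * b)"
    by (simp add: algebra_simps power2_eq_square)
  have "q^2 * (a * b + q * (a + b)) \<le> q^2 * (q * n)"
    using ST by (intro mult_left_mono) auto
  with 1 have 2: "(q * (k + q) + q^3) * (a + b) \<le> q^3 * n + (k + q)^2"
    by (simp add: algebra_simps power2_eq_square power3_eq_cube)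
  have "(q * (k + q) + q^3) * (n - k + 1) \<le> (q * (k + q) + q^3) * (a + b)"
    using big q k by (intro mult_left_mono) auto
  with 2 have "(q * (k + q) + q^3) * (n - k + 1) \<le> q^3 * n + (k + q)^2" by linarith
  \<comment> \<open>After substituting \<open>n\<close>, all terms linear in \<open>k\<close> cancel
    and a factor \<open>q + 1\<close> splits off.\<close>
  then have "(q + 1) * (q^2 * (q + 1)) \<le> (q + 1) * k^2"
    unfolding n by (simp add: algebra_simps power2_eq_square power3_eq_cube)
  then have 3: "q^2 * (q + 1) \<le> k^2" using q by simp
  moreover have "q^2 * 1 \<le> q^2 * (q + 1)" using q by (intro mult_left_mono) auto
  ultimately have "q^2 \<le> k^2" by linarith
  then have "q \<le> k" using k by (simp add: power2_le_iff_abs_le)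
  then have "q * q \<le> q * k" using q by simp
  \<comment> \<open>Since \<open>q * n = q^2 * (q + 1) + q\<close>, inserting \<open>3\<close> into
    \<open>XY\<close> leaves only \<open>q\<close> on the right, too little for
    \<open>q \<le> k\<close>.\<close>
  moreover have "2 * (q * k) \<le> q"
    using 3 XY unfolding n by (simp add: algebra_simps power2_eq_square)
  moreover have "q * 1 \<le> q * q" using q by (intro mult_left_mono) auto
  ultimately show False using q by linarith
qed

text \<open>Replacing the quadrangle by the dual of the line size condition makes the axioms self-dual.\<close>

locale biregular_plane =
  fixes Points :: "'p set" and Lines :: "'l set" and inc :: "'p \<Rightarrow> 'l \<Rightarrow> bool" and q :: nat
  assumes points_nonempty: "Points \<noteq> {}"
    and lines_nonempty: "Lines \<noteq> {}"
    and unique_line: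
      "\<lbrakk>P \<in> Points; Q \<in> Points; P \<noteq> Q\<rbrakk> \<Longrightarrow> \<exists>!l. l \<in> Lines \<and> inc P l \<and> inc Q l"
    and unique_point:
      "\<lbrakk>l \<in> Lines; m \<in> Lines; l \<noteq> m\<rbrakk> \<Longrightarrow> \<exists>!P. P \<in> Points \<and> inc P l \<and> inc P m"
    and line_size: "l \<in> Lines \<Longrightarrow> card {P \<in> Points. inc P l} = q + 1"
    and pencil_size: "P \<in> Points \<Longrightarrow> card {l \<in> Lines. inc P l} = q + 1"
begin

section \<open>Duality and the numbers of points and lines\<close>

lemma dual: "biregular_plane Lines Points (\<lambda>l P. inc P l) q"
  by unfold_locales
    (use points_nonempty lines_nonempty unique_line unique_point line_size pencil_size in auto)

lemma finite_line: "l \<in> Lines \<Longrightarrow> finite {P \<in> Points. inc P l}"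
  using line_size by (intro card_ge_0_finite) simp

lemma finite_pencil: "P \<in> Points \<Longrightarrow> finite {l \<in> Lines. inc P l}"
  using pencil_size by (intro card_ge_0_finite) simp

lemma card_line_minus_point:
  assumes "l \<in> Lines" "P \<in> Points" "inc P l"
  shows "card ({Q \<in> Points. inc Q l} - {P}) = q"
  using assms line_size by simp

lemma points_decomp:
  assumes "P \<in> Points"
  shows "Points - {P} = (\<Union>l\<in>{l \<in> Lines. inc P l}. {Q \<in> Points. inc Q l} - {P})"
  using unique_line[OF assms] by blast

lemma finite_points: "finite Points"
proof -
  obtain P where P: "P \<in> Points" using points_nonempty by blast
  have "finite (Points - {P})"
    unfolding points_decomp[OF P] using finite_pencil[OF P] finite_line by auto
  then show ?thesis by simp
qed

lemma card_points: "card Points = q^2 + q + 1"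
proof -
  obtain P where P: "P \<in> Points" using points_nonempty by blast
  have "card (Points - {P}) = (\<Sum>l\<in>{l \<in> Lines. inc P l}. card ({Q \<in> Points. inc Q l} - {P}))"
    unfolding points_decomp[OF P]
  proof (rule card_UN_disjoint)
    show "finite {l \<in> Lines. inc P l}" by (rule finite_pencil[OF P])
    show "\<forall>l\<in>{l \<in> Lines. inc P l}. finite ({Q \<in> Points. inc Q l} - {P})"
      using finite_line by auto
    show "\<forall>l\<in>{l \<in> Lines. inc P l}. \<forall>m\<in>{l \<in> Lines. inc P l}. l \<noteq> m \<longrightarrow>
        ({Q \<in> Points. inc Q l} - {P}) \<inter> ({Q \<in> Points. inc Q m} - {P}) = {}"
      using unique_line[OF P] by blast
  qed
  also have "\<dots> = (\<Sum>l\<in>{l \<in> Lines. inc P l}. q)"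
    using P by (intro sum.cong refl card_line_minus_point) auto
  also have "\<dots> = (q + 1) * q"
    using pencil_size[OF P] by simp
  finally have "card Points - 1 = (q + 1) * q"
    using P by simp
  \<comment> \<open>Positivity undoes the truncated subtraction in
    \<open>card Points - 1\<close>.\<close>
  moreover have "card Points > 0"
    using P finite_points card_gt_0_iff by blast
  ultimately show ?thesis
    by (simp add: power2_eq_square)
qed

lemmas finite_lines = biregular_plane.finite_points[OF dual]
  and card_lines = biregular_plane.card_points[OF dual]

lemma card_common_lines:
  assumes "P \<in> Points" "Q \<in> Points"
  shows "card {l \<in> Lines. inc P l \<and> inc Q l} = (if P = Q then q + 1 else 1)"
proof (cases "P = Q")
  case True
  then show ?thesis using pencil_size assms by simp
next
  case False
  then obtain l where "{l \<in> Lines. inc P l \<and> inc Q l} = {l}"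
    using unique_line[OF assms False] by blast
  then show ?thesis using False by simp
qed

section \<open>Inequalities for nonincident pairs\<close>

text \<open>Let \<open>x l\<close> be the number of points of \<open>S\<close> on \<open>l\<close>.
  It vanishes on \<open>T\<close>, so its first two moments over all lines are sums over
  \<open>Lines - T\<close>, to which Cauchy-Schwarz applies.\<close>

lemma mixing_inequality:
  assumes S: "S \<subseteq> Points" and T: "T \<subseteq> Lines" and non: "\<And>P l. P \<in> S \<Longrightarrow> l \<in> T \<Longrightarrow> \<not> inc P l"
  shows "card S * card T + q * (card S + card T) \<le> q * (q^2 + q + 1)"
proof (cases "S = {}")
  case True
  have "card T \<le> q^2 + q + 1"
    using card_mono[OF finite_lines T] card_lines by simp
  then have "q * card T \<le> q * (q^2 + q + 1)" by (rule mult_le_mono2)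
  then show ?thesis using True by simp
next
  case False
  have finS: "finite S" using S finite_points finite_subset by blast
  define x where "x l = (\<Sum>P\<in>S. if inc P l then 1 else (0::real))" for l
  define a b n :: real where "a = card S" and "b = card T" and "n = q^2 + q + 1"
  have count: "(\<Sum>l\<in>Lines. if inc P l \<and> inc Q l then 1 else (0::real)) = (if P = Q then q + 1 else 1)"
    if "P \<in> S" "Q \<in> S" for P Q
    using card_common_lines[of P Q] subsetD[OF S that(1)] subsetD[OF S that(2)] finite_lines
    by (auto simp: sum.If_cases Int_def)
  have x0: "x l = 0" if "l \<in> T" for l
    unfolding x_def using non that by (intro sum.neutral) auto
  have "sum x (Lines - T) = sum x Lines"
    using x0 finite_lines by (intro sum.mono_neutral_left) auto
  also have "\<dots> = (\<Sum>P\<in>S. \<Sum>l\<in>Lines. if inc P l \<and> inc P l then 1 else 0)"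
    unfolding x_def by (subst sum.swap) simp
  also have "\<dots> = (\<Sum>P\<in>S. real (q + 1))"
    by (intro sum.cong refl) (subst count, simp_all)
  also have "\<dots> = a * (q + 1)" by (simp add: a_def)
  finally have sum1: "sum x (Lines - T) = a * (q + 1)" .
  have "(\<Sum>l\<in>Lines - T. (x l)^2) = (\<Sum>l\<in>Lines. (x l)^2)"
    using x0 finite_lines by (intro sum.mono_neutral_left) auto
  \<comment> \<open>Double counting of triples \<open>(P, Q, l)\<close> with both points on
    \<open>l\<close>: a diagonal pair lies on \<open>q + 1\<close> lines, any other pair on
    one.\<close>
  also have "\<dots> = (\<Sum>l\<in>Lines. \<Sum>P\<in>S. \<Sum>Q\<in>S. if inc P l \<and> inc Q l then 1 else 0)"
    unfolding x_def power2_eq_square sum_product by (intro sum.cong refl) auto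
  also have "\<dots> = (\<Sum>P\<in>S. \<Sum>Q\<in>S. \<Sum>l\<in>Lines. if inc P l \<and> inc Q l then 1 else 0)"
    by (subst sum.swap) (intro sum.cong refl sum.swap)
  also have "\<dots> = (\<Sum>P\<in>S. \<Sum>Q\<in>S. (if P = Q then real q else 0) + 1)"
    using count by (intro sum.cong refl) auto
  also have "\<dots> = a * (q + a)"
    using finS by (simp add: sum.distrib a_def)
  finally have sum2: "(\<Sum>l\<in>Lines - T. (x l)^2) = a * (q + a)" .
  have "card (Lines - T) = card Lines - card T" "card T \<le> card Lines"
    using T finite_lines by (auto intro!: card_Diff_subset card_mono intro: finite_subset)
  then have cardLT: "real (card (Lines - T)) = n - b"
    using card_lines by (simp add: n_def b_def of_nat_diff)
  have "(sum x (Lines - T))^2 \<le> (\<Sum>l\<in>Lines - T. (x l)^2) * card (Lines - T)"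
    by (rule sum_squared_le_sum_of_squares)
  then have "a * (a * (q + 1)^2) \<le> a * ((q + a) * (n - b))"
    unfolding sum1 sum2 cardLT by (simp add: power2_eq_square algebra_simps)
  moreover have "a > 0"
    using False finS by (simp add: a_def card_gt_0_iff)
  ultimately have "a * (q + 1)^2 \<le> (q + a) * (n - b)"
    by simp
  \<comment> \<open>As \<open>(q + 1)^2 = n + q\<close>, the term \<open>a * n\<close> cancels on
    both sides.\<close>
  then have "a * b + q * (a + b) \<le> q * n"
    by (simp add: n_def power2_eq_square algebra_simps)
  then have "real (card S * card T + q * (card S + card T)) \<le> real (q * (q^2 + q + 1))"
    by (simp add: a_def b_def n_def algebra_simps)
  then show ?thesis by (simp only: of_nat_le_iff)
qed

text \<open>Fix \<open>s\<close> in \<open>S\<close>. A line joining \<open>s\<close> to a point of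
  \<open>X\<close> is outside \<open>Y\<close> because it meets \<open>X\<close>, and outside
  \<open>T\<close> because it meets \<open>S\<close>. Each such line carries only \<open>q\<close>
  points besides \<open>s\<close>, and there are at most
  \<open>q^2 + q + 1 - card Y - card T\<close> of them.\<close>

lemma card_le_joining_lines:
  assumes X: "X \<subseteq> Points" and Y: "Y \<subseteq> Lines" and S: "S \<subseteq> Points - X" and T: "T \<subseteq> Lines - Y"
    and XY: "\<And>P l. P \<in> X \<Longrightarrow> l \<in> Y \<Longrightarrow> \<not> inc P l"
    and ST: "\<And>P l. P \<in> S \<Longrightarrow> l \<in> T \<Longrightarrow> \<not> inc P l"
    and "S \<noteq> {}"
  shows "card X + q * (card Y + card T) \<le> q * (q^2 + q + 1)"
proof -
  obtain s where s: "s \<in> S" using \<open>S \<noteq> {}\<close> by blast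
  then have sP: "s \<in> Points" using S by blast
  define D where "D = {l \<in> Lines - Y - T. inc s l}"
  have finD: "finite D" using finite_lines by (simp add: D_def)
  have "X \<subseteq> (\<Union>l\<in>D. {Q \<in> Points. inc Q l} - {s})"
  proof
    fix x assume x: "x \<in> X"
    then have "x \<in> Points" "x \<noteq> s" using X S s by auto
    then obtain l where "l \<in> Lines" "inc s l" "inc x l"
      using unique_line[OF sP] by metis
    then show "x \<in> (\<Union>l\<in>D. {Q \<in> Points. inc Q l} - {s})"
      using x s XY ST \<open>x \<in> Points\<close> \<open>x \<noteq> s\<close> by (auto simp: D_def)
  qed
  then have "card X \<le> card (\<Union>l\<in>D. {Q \<in> Points. inc Q l} - {s})"
    using finite_points finD by (intro card_mono) auto
  also have "\<dots> \<le> (\<Sum>l\<in>D. card ({Q \<in> Points. inc Q l} - {s}))"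
    by (rule card_UN_le[OF finD])
  also have "\<dots> = (\<Sum>l\<in>D. q)"
    using sP by (intro sum.cong refl card_line_minus_point) (auto simp: D_def)
  also have "\<dots> = q * card D" by simp
  finally have "card X \<le> q * card D" .
  moreover have "card D + (card Y + card T) \<le> q^2 + q + 1"
  proof -
    have fin: "finite Y" "finite T" using Y T finite_lines finite_subset by blast+
    have "card D + (card Y + card T) = card (D \<union> (Y \<union> T))"
      using fin finD T by (subst card_Un_disjoint; (subst card_Un_disjoint)?) (auto simp: D_def)
    also have "\<dots> \<le> card Lines"
      using Y T finite_lines by (intro card_mono) (auto simp: D_def)
    finally show ?thesis using card_lines by simp
  qed
  then have "q * (card D + (card Y + card T)) \<le> q * (q^2 + q + 1)"
    by (rule mult_le_mono2)
  ultimately show ?thesis by (simp add: algebra_simps)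
qed

text \<open>This is Hall's condition for the complements of \<open>X\<close> and \<open>Y\<close> in
  symmetric form: the sizes of a nonincident pair \<open>S\<close>, \<open>T\<close> there add up to
  at most the size of one complement.\<close>

lemma nonincident_card_bound:
  assumes X: "X \<subseteq> Points" and Y: "Y \<subseteq> Lines" and S: "S \<subseteq> Points - X" and T: "T \<subseteq> Lines - Y"
    and XY: "\<And>P l. P \<in> X \<Longrightarrow> l \<in> Y \<Longrightarrow> \<not> inc P l"
    and ST: "\<And>P l. P \<in> S \<Longrightarrow> l \<in> T \<Longrightarrow> \<not> inc P l"
    and eq: "card X = card Y"
  shows "card S + card T + card X \<le> q^2 + q + 1"
proof (rule ccontr)
  assume *: "\<not> ?thesis"
  have fin: "finite S" "finite T"
    using S T finite_points finite_lines by (auto intro: finite_subset)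
  have "card S + card X = card (S \<union> X)" "card T + card Y = card (T \<union> Y)"
    using X Y S T finite_points finite_lines
    by (auto intro!: card_Un_disjoint[symmetric] intro: finite_subset)
  moreover have "card (S \<union> X) \<le> q^2 + q + 1" "card (T \<union> Y) \<le> q^2 + q + 1"
    using card_mono[of Points "S \<union> X"] card_mono[of Lines "T \<union> Y"] X Y S T
      finite_points finite_lines card_points card_lines by auto
  \<comment> \<open>If one of the sets were empty, the other would by \<open>*\<close> be larger
    than the complement containing it.\<close>
  ultimately have "T \<noteq> {}" "S \<noteq> {}"
    using * eq by auto
  define n where "n = q^2 + q + 1"
  have big: "n + 1 \<le> card S + card T + card X"
    using * by (simp add: n_def)
  have 1: "card X + q * (card Y + card T) \<le> q * n"
    unfolding n_def using card_le_joining_lines[OF X Y S T XY ST \<open>S \<noteq> {}\<close>] by simp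
  have 2: "card Y + q * (card X + card S) \<le> q * n"
    unfolding n_def
    using biregular_plane.card_le_joining_lines[OF dual Y X T S _ _ \<open>T \<noteq> {}\<close>] XY ST by auto
  have "q * (n + 1) \<le> q * (card S + card T + card X)"
    using big by (rule mult_le_mono2)
  \<comment> \<open>Adding \<open>1\<close> to \<open>q\<close> times \<open>big\<close> cancels
    \<open>card T\<close> and \<open>n\<close>; the \<open>+ 1\<close> in \<open>big\<close> yields
    the summand \<open>q\<close>. The dual inequality \<open>2\<close> does the same for
    \<open>T\<close>.\<close>
  with 1 2 eq have a: "card X + q \<le> q * card S" and b: "card X + q \<le> q * card T"
    by (auto simp: algebra_simps)
  have X2: "card X * card X + q * (card X + card X) \<le> q * n"
    unfolding n_def using mixing_inequality[OF X Y XY] eq by simp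
  have ST2: "card S * card T + q * (card S + card T) \<le> q * n"
    unfolding n_def using S T ST by (intro mixing_inequality) auto
  have pos: "1 \<le> card S" "1 \<le> card T"
    using \<open>S \<noteq> {}\<close> \<open>T \<noteq> {}\<close> fin by (simp_all add: card_gt_0_iff Suc_le_eq)
  show False
  proof (rule nonincident_bounds_contradictory[of "int n" "int q" "int (card S)" "int (card T)" "int (card X)"])
    show "int n = int q^2 + int q + 1" by (simp add: n_def)
  qed (use X2 ST2 pos a b big in \<open>simp_all flip: of_nat_add of_nat_mult\<close>)
qed

section \<open>Matchings of complements and covers by chambers\<close>

lemma complement_matching:
  assumes X: "X \<subseteq> Points" and Y: "Y \<subseteq> Lines" and eq: "card X = card Y"
    and XY: "\<And>P l. P \<in> X \<Longrightarrow> l \<in> Y \<Longrightarrow> \<not> inc P l"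
  obtains f where "bij_betw f (Points - X) (Lines - Y)" "\<And>P. P \<in> Points - X \<Longrightarrow> inc P (f P)"
proof -
  have fin: "finite (Points - X)" "finite (Lines - Y)" "finite X" "finite Y"
    using finite_points finite_lines X Y by (auto intro: finite_subset)
  have cards: "card (Points - X) = q^2 + q + 1 - card X" "card (Lines - Y) = q^2 + q + 1 - card X"
    using fin X Y eq card_points card_lines by (simp_all add: card_Diff_subset)
  have "\<exists>f. inj_on f (Points - X) \<and> (\<forall>P\<in>Points - X. f P \<in> {l \<in> Lines - Y. inc P l})"
  proof (rule hall_marriage)
    show "finite (Points - X)" by (rule fin)
    show "finite {l \<in> Lines - Y. inc P l}" for P using finite_lines by simp
    fix S assume S: "S \<subseteq> Points - X"
    define M where "M = (\<Union>P\<in>S. {l \<in> Lines - Y. inc P l})"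
    \<comment> \<open>The lines of \<open>Lines - Y\<close> that miss \<open>S\<close> play the role
      of \<open>T\<close>; since \<open>Lines - Y\<close> has \<open>q^2 + q + 1 - card X\<close>
      elements, the bound becomes \<open>card S \<le> card M\<close>.\<close>
    have "card S + card (Lines - Y - M) + card X \<le> q^2 + q + 1"
      using XY by (intro nonincident_card_bound[OF X Y S _ _ _ eq]) (auto simp: M_def)
    moreover have M: "M \<subseteq> Lines - Y" by (auto simp: M_def)
    then have "card (Lines - Y - M) = card (Lines - Y) - card M"
      using fin by (intro card_Diff_subset) (auto intro: finite_subset)
    moreover have "card X \<le> q^2 + q + 1"
      using card_mono[OF finite_points X] card_points by simp
    moreover have "card M \<le> card (Lines - Y)"
      using M fin by (intro card_mono)
    ultimately show "card S \<le> card (\<Union>P\<in>S. {l \<in> Lines - Y. inc P l})"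
      using cards unfolding M_def[symmetric] by linarith
  qed
  then obtain f where f: "inj_on f (Points - X)"
    "\<And>P. P \<in> Points - X \<Longrightarrow> f P \<in> Lines - Y \<and> inc P (f P)" by auto
  \<comment> \<open>An injection between finite sets of equal size is onto.\<close>
  then have "f ` (Points - X) = Lines - Y"
    using fin cards by (intro card_subset_eq) (auto simp: card_image)
  then show thesis
    using that[of f] f by (auto simp: bij_betw_def)
qed

lemma chamber_cover_iff:
  assumes t: "t \<le> q^2 + q + 1"
  shows "(\<exists>p l. (\<forall>i\<in>{1..t}. (p i, l i) \<in> chambers Points Lines inc) \<and>
             (\<forall>(P, m) \<in> chambers Points Lines inc. \<exists>i\<in>{1..t}. P = p i \<or> m = l i))
      \<longleftrightarrow>
      (\<exists>X Y. X \<subseteq> Points \<and> Y \<subseteq> Lines \<and>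
             card X = q^2 + q + 1 - t \<and> card Y = q^2 + q + 1 - t \<and>
             (\<forall>P\<in>X. \<forall>m\<in>Y. \<not> inc P m))"
    (is "?cover \<longleftrightarrow> ?nonincident")
proof
  assume ?cover
  then obtain p l where pl: "\<And>i. i \<in> {1..t} \<Longrightarrow> (p i, l i) \<in> chambers Points Lines inc"
    and cover: "\<forall>(P, m) \<in> chambers Points Lines inc. \<exists>i\<in>{1..t}. P = p i \<or> m = l i" by blast
  \<comment> \<open>Points or lines may repeat among the chambers, so the complements can have more
    than \<open>q^2 + q + 1 - t\<close> elements and are cut down to subsets of that size.\<close>
  have "card (p ` {1..t}) \<le> t" "card (l ` {1..t}) \<le> t"
    using card_image_le[of "{1..t}" p] card_image_le[of "{1..t}" l] by simp_all
  moreover have "card (Points - p ` {1..t}) \<ge> card Points - card (p ` {1..t})"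
    "card (Lines - l ` {1..t}) \<ge> card Lines - card (l ` {1..t})"
    by (auto intro!: diff_card_le_card_Diff)
  ultimately have "q^2 + q + 1 - t \<le> card (Points - p ` {1..t})"
    "q^2 + q + 1 - t \<le> card (Lines - l ` {1..t})"
    using card_points card_lines by linarith+
  then obtain X Y where "X \<subseteq> Points - p ` {1..t}" "card X = q^2 + q + 1 - t"
    "Y \<subseteq> Lines - l ` {1..t}" "card Y = q^2 + q + 1 - t"
    using obtain_subset_with_card_n by meson
  \<comment> \<open>An incident pair from \<open>X\<close> and \<open>Y\<close> would be an
    uncovered chamber.\<close>
  moreover from this have "\<forall>P\<in>X. \<forall>m\<in>Y. \<not> inc P m"
    using cover unfolding chambers_def by fast
  ultimately show ?nonincident by blast
next
  assume ?nonincident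
  then obtain X Y where X: "X \<subseteq> Points" and Y: "Y \<subseteq> Lines"
    and cX: "card X = q^2 + q + 1 - t" and cY: "card Y = q^2 + q + 1 - t"
    and XY: "\<And>P m. P \<in> X \<Longrightarrow> m \<in> Y \<Longrightarrow> \<not> inc P m" by blast
  obtain f where f: "bij_betw f (Points - X) (Lines - Y)"
    and inc_f: "\<And>P. P \<in> Points - X \<Longrightarrow> inc P (f P)"
    using complement_matching[OF X Y _ XY] cX cY by auto
  \<comment> \<open>By \<open>t\<close>, the subtraction in \<open>cX\<close> is not truncated, so
    exactly \<open>t\<close> indices enumerate the matching edges.\<close>
  have "card (Points - X) = t"
    using X finite_points card_points cX t by (simp add: card_Diff_subset finite_subset)
  then obtain p where p: "bij_betw p {1..t} (Points - X)"
    using finite_points finite_same_card_bij[of "{1..t}" "Points - X"] by auto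
  have fp: "bij_betw (f \<circ> p) {1..t} (Lines - Y)"
    using p f by (rule bij_betw_trans)
  have "(p i, (f \<circ> p) i) \<in> chambers Points Lines inc" if "i \<in> {1..t}" for i
    using bij_betw_apply[OF p that] bij_betw_apply[OF fp that] inc_f by (simp add: chambers_def)
  moreover have "\<exists>i\<in>{1..t}. P = p i \<or> m = (f \<circ> p) i" if "(P, m) \<in> chambers Points Lines inc" for P m
  proof -
    have "P \<in> Points - X \<or> m \<in> Lines - Y"
      using that XY by (auto simp: chambers_def)
    then have "P \<in> p ` {1..t} \<or> m \<in> (f \<circ> p) ` {1..t}"
      using p fp by (simp add: bij_betw_def)
    then show ?thesis by blast
  qed
  ultimately show ?cover by (intro exI[of _ p] exI[of _ "f \<circ> p"]) auto
qed

end

section \<open>Projective planes of order \<open>q\<close>\<close>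

context projective_plane
begin

text \<open>Three points \<open>A\<close>, \<open>B\<close>, \<open>C\<close> of the quadrangle
  differ from \<open>P\<close> and are not collinear. The lines \<open>AB\<close> and
  \<open>AC\<close> meet only in \<open>A\<close>, so at most one of them passes through
  \<open>P\<close>.\<close>

lemma line_avoiding_point:
  assumes P: "P \<in> Points"
  obtains l where "l \<in> Lines" "\<not> inc P l"
proof -
  obtain Q where Q: "Q \<subseteq> Points" "card Q = 4" "\<forall>l \<in> Lines. card {P \<in> Q. inc P l} \<le> 2"
    using quadrangle by blast
  then have finQ: "finite Q" by (simp add: card_ge_0_finite)
  have "card (Q - {P}) \<ge> 3" using Q(2) by (simp add: card_Diff_singleton_if)
  then obtain T where "T \<subseteq> Q - {P}" "card T = 3"
    by (metis obtain_subset_with_card_n)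
  then obtain A B C where ABC: "{A, B, C} \<subseteq> Q - {P}" "A \<noteq> B" "A \<noteq> C" "B \<noteq> C"
    by (auto simp: card_3_iff)
  obtain l where l: "l \<in> Lines" "inc A l" "inc B l"
    using unique_line[of A B] ABC Q(1) by auto
  obtain m where m: "m \<in> Lines" "inc A m" "inc C m"
    using unique_line[of A C] ABC Q(1) by auto
  have "l \<noteq> m"
  proof
    assume "l = m"
    then have "{A, B, C} \<subseteq> {P \<in> Q. inc P l}" using l m ABC by auto
    then have "card {A, B, C} \<le> card {P \<in> Q. inc P l}" using finQ by (intro card_mono) auto
    with bspec[OF Q(3) l(1)] ABC(2-4) show False by simp
  qed
  then have "\<not> inc P l \<or> \<not> inc P m"
    using unique_point[OF l(1) m(1)] l m ABC P Q(1) by auto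
  then show thesis using that l m by blast
qed

end

context projective_plane_of_order
begin

text \<open>Projection from \<open>P\<close> onto a line \<open>m\<close> not through
  \<open>P\<close>: joining to \<open>P\<close> is a bijection from the points of \<open>m\<close>
  to the lines through \<open>P\<close>.\<close>

lemma card_pencil:
  assumes P: "P \<in> Points"
  shows "card {l \<in> Lines. inc P l} = q + 1"
proof -
  obtain m where m: "m \<in> Lines" "\<not> inc P m" using line_avoiding_point[OF P] .
  define join where "join R = (THE l. l \<in> Lines \<and> inc P l \<and> inc R l)" for R
  have join: "join R \<in> Lines \<and> inc P (join R) \<and> inc R (join R)" if "R \<in> Points" "inc R m" for R
    unfolding join_def by (rule theI') (use that P m unique_line in blast)
  have "bij_betw join {R \<in> Points. inc R m} {l \<in> Lines. inc P l}"
  proof (rule bij_betw_imageI)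
    show "inj_on join {R \<in> Points. inc R m}"
    proof (rule inj_onI)
      fix R R' assume R: "R \<in> {R \<in> Points. inc R m}" "R' \<in> {R \<in> Points. inc R m}" "join R = join R'"
      then have "join R \<in> Lines" "join R \<noteq> m" using join m by auto
      from unique_point[OF this(1) m(1) this(2)] show "R = R'"
        using R join[of R] join[of R'] by auto
    qed
    show "join ` {R \<in> Points. inc R m} = {l \<in> Lines. inc P l}"
    proof (intro equalityI subsetI)
      fix l assume l: "l \<in> {l \<in> Lines. inc P l}"
      then have "l \<noteq> m" using m by auto
      then obtain R where R: "R \<in> Points" "inc R l" "inc R m"
        using unique_point[of l m] l m by auto
      then have "P \<noteq> R" using m by auto
      from unique_line[OF P R(1) this] have "join R = l"
        using join[OF R(1,3)] l R by auto
      with R show "l \<in> join ` {R \<in> Points. inc R m}" by auto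
    qed (use join in auto)
  qed
  then show ?thesis using bij_betw_same_card line_size[OF m(1)] by metis
qed

sublocale biregular_plane Points Lines inc q
proof unfold_locales
  obtain Q where Q: "Q \<subseteq> Points" "card Q = 4" using quadrangle by blast
  then obtain P where P: "P \<in> Points" by fastforce
  then show "Points \<noteq> {}" by blast
  show "Lines \<noteq> {}" using line_avoiding_point[OF P] by blast
qed (use unique_line unique_point line_size card_pencil in auto)

end

section \<open>Covers as colorings of the Kneser graph\<close>

text \<open>If both chambers share the point or both share the line of \<open>c\<close>, their own
  incidences suffice; in the mixed case the incidence of \<open>c\<close> itself excludes
  adjacency.\<close>

lemma chamber_coclique_independent:
  assumes "c \<in> chambers Points Lines inc"
    and "u \<in> chamber_coclique Points Lines inc c" "v \<in> chamber_coclique Points Lines inc c"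
  shows "\<not> kneser_adj inc u v"
  using assms by (auto simp: chamber_coclique_def kneser_adj_def chambers_def)

text \<open>A cover colors each chamber by some index that covers it, and independence of the
  cocliques makes this proper. Conversely, the chambers whose cocliques contain the color classes
  form a cover.\<close>

lemma chamber_cover_iff_coloring:
  "(\<exists>p l. (\<forall>i\<in>{1..t}. (p i, l i) \<in> chambers Points Lines inc) \<and>
             (\<forall>(P, m) \<in> chambers Points Lines inc. \<exists>i\<in>{1..t}. P = p i \<or> m = l i))
      \<longleftrightarrow>
      (\<exists>f. proper_coloring (chambers Points Lines inc) (kneser_adj inc) t f \<and>
           (\<forall>i\<in>{1..t}. \<exists>c \<in> chambers Points Lines inc.
              {d \<in> chambers Points Lines inc. f d = i} \<subseteq> chamber_coclique Points Lines inc c))"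
    (is "?cover \<longleftrightarrow> ?coloring")
proof
  let ?C = "chambers Points Lines inc"
  assume ?cover
  then obtain p l where pl: "\<And>i. i \<in> {1..t} \<Longrightarrow> (p i, l i) \<in> ?C"
    and cover: "\<forall>(P, m) \<in> ?C. \<exists>i\<in>{1..t}. P = p i \<or> m = l i" by blast
  have "\<forall>d\<in>?C. \<exists>i\<in>{1..t}. d \<in> chamber_coclique Points Lines inc (p i, l i)"
    using cover by (fastforce simp: chamber_coclique_def)
  then obtain f where f: "\<And>d. d \<in> ?C \<Longrightarrow> f d \<in> {1..t}"
    "\<And>d. d \<in> ?C \<Longrightarrow> d \<in> chamber_coclique Points Lines inc (p (f d), l (f d))"
    by metis
  have "proper_coloring ?C (kneser_adj inc) t f"
    unfolding proper_coloring_def using f chamber_coclique_independent[OF pl] by (metis image_subsetI)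
  moreover have "\<forall>i\<in>{1..t}. \<exists>c\<in>?C. {d \<in> ?C. f d = i} \<subseteq> chamber_coclique Points Lines inc c"
  proof
    fix i assume "i \<in> {1..t}"
    then show "\<exists>c\<in>?C. {d \<in> ?C. f d = i} \<subseteq> chamber_coclique Points Lines inc c"
      using f(2) by (intro bexI[OF _ pl]) auto
  qed
  ultimately show ?coloring by blast
next
  let ?C = "chambers Points Lines inc"
  assume ?coloring
  then obtain f where f: "f ` ?C \<subseteq> {1..t}"
    and cl: "\<forall>i\<in>{1..t}. \<exists>c\<in>?C. {d \<in> ?C. f d = i} \<subseteq> chamber_coclique Points Lines inc c"
    unfolding proper_coloring_def by blast
  \<comment> \<open>One chamber is chosen for every color, including colors with an empty class, so
    that exactly the indices \<open>1\<close> to \<open>t\<close> are served.\<close>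
  from bchoice[OF cl[unfolded Bex_def]] obtain c where c: "\<And>i. i \<in> {1..t} \<Longrightarrow> c i \<in> ?C"
    and sub: "\<And>i. i \<in> {1..t} \<Longrightarrow> {d \<in> ?C. f d = i} \<subseteq> chamber_coclique Points Lines inc (c i)"
    by blast
  have "\<exists>i\<in>{1..t}. P = fst (c i) \<or> m = snd (c i)" if "(P, m) \<in> ?C" for P m
  proof -
    have "f (P, m) \<in> {1..t}" using f that by blast
    moreover from sub[OF this] that have "(P, m) \<in> chamber_coclique Points Lines inc (c (f (P, m)))"
      by blast
    ultimately show ?thesis by (auto simp: chamber_coclique_def)
  qed
  then show ?cover
    using c by (intro exI[of _ "\<lambda>i. fst (c i)"] exI[of _ "\<lambda>i. snd (c i)"]) auto
qed

theorem theorem2: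
  fixes Points :: "'p set" and Lines :: "'l set" and inc :: "'p \<Rightarrow> 'l \<Rightarrow> bool"
    and q t :: nat
  assumes "projective_plane_of_order Points Lines inc q"
    and "t \<le> q^2 + q + 1"
  shows
    "((\<exists>p l. (\<forall>i\<in>{1..t}. (p i, l i) \<in> chambers Points Lines inc) \<and>
             (\<forall>(P, m) \<in> chambers Points Lines inc. \<exists>i\<in>{1..t}. P = p i \<or> m = l i))
      \<longleftrightarrow>
      (\<exists>X Y. X \<subseteq> Points \<and> Y \<subseteq> Lines \<and>
             card X = q^2 + q + 1 - t \<and> card Y = q^2 + q + 1 - t \<and>
             (\<forall>P\<in>X. \<forall>m\<in>Y. \<not> inc P m)))
     \<and>
     ((\<exists>p l. (\<forall>i\<in>{1..t}. (p i, l i) \<in> chambers Points Lines inc) \<and>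
             (\<forall>(P, m) \<in> chambers Points Lines inc. \<exists>i\<in>{1..t}. P = p i \<or> m = l i))
      \<longleftrightarrow>
      (\<exists>f. proper_coloring (chambers Points Lines inc) (kneser_adj inc) t f \<and>
           (\<forall>i\<in>{1..t}. \<exists>c \<in> chambers Points Lines inc.
              {d \<in> chambers Points Lines inc. f d = i} \<subseteq> chamber_coclique Points Lines inc c)))"
proof -
  interpret projective_plane_of_order Points Lines inc q by (rule assms(1))
  show ?thesis
    using chamber_cover_iff[OF assms(2)] chamber_cover_iff_coloring by (rule conjI)
qed

end
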